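(* Let $\mathfrak{X}$ be a complex vector space and let $\mathfrak{Y}$ be an ordered Banach bimodule over a *-algebra $\mathfrak{Y}_0$ with closed positive cone $\mathfrak{K}$, where $\mathfrak{Y}_0$ is equipped with a (not necessarily submultiplicative) norm $\|\cdot\|_{\mathfrak{Y}_0}$ and with the cone $$\mathfrak{K}_0=\Big\{\sum_{i=1}^N z_i^*z_i:\ z_i\in\mathfrak{Y}_0,\ i=1,\dots,N,\ N\in\mathbb{N}\Big\}.$$ Assume the following two conditions. (C1) Every $z\in\mathfrak{Y}_0$ can be written as $z=z_1-z_2+i(z_3-z_4)$ with $z_j\in\mathfrak{K}_0$, $\|z_1-z_2\|_{\mathfrak{Y}_0}=\|z_1+z_2\|_{\mathfrak{Y}_0}\le\|z\|_{\mathfrak{Y}_0}$ and $\|z_3-z_4\|_{\mathfrak{Y}_0}=\|z_3+z_4\|_{\mathfrak{Y}_0}\le\|z\|_{\mathfrak{Y}_0}$. (C2) There exists a family $\mathcal{F}$ of sesquilinear forms $\varphi:\mathfrak{Y}\times\mathfrak{Y}_0\to\mathbb{C}$ such that: (i) $\varphi(y^+,z^+)\ge0$ for all $y^+\in\mathfrak{K}$, $z^+\in\mathfrak{K}_0$, $\varphi\in\mathcal{F}$; (ii) $|\varphi(y,z)|\le\|y\|_{\mathfrak{Y}}\|z\|_{\mathfrak{Y}_0}$ for all $y\in\mathfrak{Y}$, $z\in\mathfrak{Y}_0$, $\varphi\in\mathcal{F}$; (iii) for every $y\in\mathfrak{Y}$, $$\|y\|_{\mathfrak{Y}}=\sup_{z\in\mathfrak{Y}_0,\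 \|z\|_{\mathfrak{Y}_0}\le1}\ \sup_{\varphi\in\mathcal{F}}|\varphi(y,z)|.$$ Let $\Phi:\mathfrak{X}\times\mathfrak{X}\to\mathfrak{Y}$ be a positive sesquilinear map. Then, for all $x_1,x_2\in\mathfrak{X}$, $$\|\Phi(x_1,x_2)\|_{\mathfrak{Y}}\le2\,\|\Phi(x_1,x_1)\|_{\mathfrak{Y}}^{1/2}\,\|\Phi(x_2,x_2)\|_{\mathfrak{Y}}^{1/2}.$$
   Context: A Banach bimodule $\mathfrak{Y}$ over a *-algebra $\mathfrak{Y}_0$ (a Banach space that is a bimodule over $\mathfrak{Y}_0$, with left and right multiplication by each fixed element of $\mathfrak{Y}_0$ bounded on $\mathfrak{Y}$) is called an ordered Banach bimodule over $\mathfrak{Y}_0$ if it contains a positive cone $\mathfrak{K}\subset\mathfrak{Y}$, i.e. $\mathfrak{K}+\mathfrak{K}\subset\mathfrak{K}$, $\lambda\mathfrak{K}\subset\mathfrak{K}$ for $\lambda\ge0$, $\mathfrak{K}\cap(-\mathfrak{K})=\{0\}$, and $z^*\mathfrak{K}z\subset\mathfrak{K}$ for all $z\in\mathfrak{Y}_0$. Sesquilinear means linear in the first variable and conjugate-linear in the second. A sesquilinear map $\Phi:\mathfrak{X}\times\mathfrak{X}\to\mathfrak{Y}$ is positive if $\Phi(x,x)\in\mathfrak{K}$ for every $x\in\mathfrak{X}$. *)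

theory Defs
  imports "HOL-Analysis.Analysis"
begin

text \<open>
  A complex normed space is a type of class \<open>real_normed_vector\<close> together with a complex scalar
  multiplication that extends \<open>scaleR\<close> and for which the norm is homogeneous.
\<close>

locale complex_normed_space = vector_space scale
  for scale :: "complex \<Rightarrow> 'a::real_normed_vector \<Rightarrow> 'a" +
  assumes scale_of_real: "scale (of_real r) x = r *\<^sub>R x"
    and norm_scale: "norm (scale c x) = cmod c * norm x"

text \<open>No unit is assumed.\<close>

locale star_algebra = vector_space scale
  for scale :: "complex \<Rightarrow> 'a::ring \<Rightarrow> 'a" +
  fixes star :: "'a \<Rightarrow> 'a"
  assumes mult_scale_left: "scale c x * y = scale c (x * y)"
    and mult_scale_right: "x * scale c y = scale c (x * y)"
    and star_star: "star (star x) = x"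
    and star_add: "star (x + y) = star x + star y"
    and star_scale: "star (scale c x) = scale (cnj c) (star x)"
    and star_mult: "star (x * y) = star y * star x"

text \<open>The case \<open>N = 0\<close> only contributes \<open>0 = star 0 * 0\<close>.\<close>

definition star_cone :: "('a::ring \<Rightarrow> 'a) \<Rightarrow> 'a set" where
  "star_cone star = {\<Sum>i<N. star (z i) * z i | (N::nat) z. True}"

locale banach_bimodule =
  alg: star_algebra scale0 star + complex_normed_space scale
  for scale0 :: "complex \<Rightarrow> 'a::ring \<Rightarrow> 'a"
    and star :: "'a \<Rightarrow> 'a"
    and scale :: "complex \<Rightarrow> 'y::banach \<Rightarrow> 'y" +
  fixes lmul :: "'a \<Rightarrow> 'y \<Rightarrow> 'y"
    and rmul :: "'y \<Rightarrow> 'a \<Rightarrow> 'y"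
  assumes lmul_add: "lmul (a + b) y = lmul a y + lmul b y"
    and rmul_add: "rmul y (a + b) = rmul y a + rmul y b"
    and lmul_scale0: "lmul (scale0 c a) y = scale c (lmul a y)"
    and rmul_scale0: "rmul y (scale0 c a) = scale c (rmul y a)"
    and lmul_scale: "lmul a (scale c y) = scale c (lmul a y)"
    and rmul_scale: "rmul (scale c y) a = scale c (rmul y a)"
    and lmul_mult: "lmul (a * b) y = lmul a (lmul b y)"
    and rmul_mult: "rmul y (a * b) = rmul (rmul y a) b"
    and lmul_rmul: "rmul (lmul a y) b = lmul a (rmul y b)"
    and bounded_linear_lmul: "bounded_linear (lmul a)"
    and bounded_linear_rmul: "bounded_linear (\<lambda>y. rmul y a)"

locale ordered_banach_bimodule = banach_bimodule scale0 star scale lmul rmul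
  for scale0 :: "complex \<Rightarrow> 'a::ring \<Rightarrow> 'a"
    and star :: "'a \<Rightarrow> 'a"
    and scale :: "complex \<Rightarrow> 'y::banach \<Rightarrow> 'y"
    and lmul :: "'a \<Rightarrow> 'y \<Rightarrow> 'y"
    and rmul :: "'y \<Rightarrow> 'a \<Rightarrow> 'y" +
  fixes K :: "'y set"
  assumes cone_add: "x \<in> K \<Longrightarrow> y \<in> K \<Longrightarrow> x + y \<in> K"
    and cone_scaleR: "x \<in> K \<Longrightarrow> 0 \<le> r \<Longrightarrow> r *\<^sub>R x \<in> K"
    and cone_pointed: "K \<inter> uminus ` K = {0}"
    and cone_star: "x \<in> K \<Longrightarrow> rmul (lmul (star z) x) z \<in> K"

text \<open>
  Linear in the first variable and conjugate-linear in the second; the latter is expressed as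
  linearity into the complex conjugate of the target space.
\<close>

definition sesquilinear ::
    "(complex \<Rightarrow> 'u::ab_group_add \<Rightarrow> 'u) \<Rightarrow> (complex \<Rightarrow> 'v::ab_group_add \<Rightarrow> 'v) \<Rightarrow>
     (complex \<Rightarrow> 'w::ab_group_add \<Rightarrow> 'w) \<Rightarrow> ('u \<Rightarrow> 'v \<Rightarrow> 'w) \<Rightarrow> bool" where
  "sesquilinear scaleU scaleV scaleW f \<longleftrightarrow>
     (\<forall>v. Vector_Spaces.linear scaleU scaleW (\<lambda>u. f u v)) \<and>
     (\<forall>u. Vector_Spaces.linear scaleV (\<lambda>c. scaleW (cnj c)) (\<lambda>v. f u v))"

definition positive_map :: "'w set \<Rightarrow> ('u \<Rightarrow> 'u \<Rightarrow> 'w) \<Rightarrow> bool" where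
  "positive_map K f \<longleftrightarrow> (\<forall>x. f x x \<in> K)"

end

theory Submission
  imports Defs
begin

text \<open>
  Testing \<open>\<Phi>\<close> against a form \<open>\<phi>\<close> of the family and an element \<open>z\<close> of the cone \<open>\<KK>\<^sub>0\<close> gives the scalar
  form \<open>\<phi> (\<Phi> x\<^sub>1 x\<^sub>2) z\<close>, which is positive semidefinite and so obeys the classical Cauchy-Schwarz
  inequality. For \<open>z\<^sub>1, z\<^sub>2\<close> in the cone, the Cauchy-Schwarz inequality in the plane combines the
  two scalar estimates into
  \<open>\<bar>\<phi> y (z\<^sub>1 - z\<^sub>2)\<bar> \<le> sqrt (\<phi> (\<Phi> x\<^sub>1 x\<^sub>1) (z\<^sub>1 + z\<^sub>2)) * sqrt (\<phi> (\<Phi> x\<^sub>2 x\<^sub>2) (z\<^sub>1 + z\<^sub>2))\<close> with \<open>y = \<Phi> x\<^sub>1 x\<^sub>2\<close>;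
  by contractivity of \<open>\<phi>\<close> the right-hand side is at most
  \<open>sqrt \<parallel>\<Phi> x\<^sub>1 x\<^sub>1\<parallel> * sqrt \<parallel>\<Phi> x\<^sub>2 x\<^sub>2\<parallel> * \<parallel>z\<^sub>1 + z\<^sub>2\<parallel>\<close> (lemma \<open>positive_form_difference_bound\<close>).
  An arbitrary \<open>z\<close> in the unit ball is \<open>p + \<i> q\<close> for two such differences \<open>p, q\<close> whose sums
  \<open>z\<^sub>1 + z\<^sub>2\<close>, \<open>z\<^sub>3 + z\<^sub>4\<close> again lie in the unit ball. This is where the constant 2 comes from.
  Since the forms are norming, the supremum over \<open>\<phi>\<close> and \<open>z\<close> yields the claim.
\<close>

lemma sesquilinearD:
  assumes "sesquilinear sU sV sW f"
  shows "f (u + u') v = f u v + f u' v"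
    and "f u (v + v') = f u v + f u v'"
    and "f (sU c u) v = sW c (f u v)"
    and "f u (sV c v) = sW (cnj c) (f u v)"
  using assms unfolding sesquilinear_def Vector_Spaces.linear_iff by auto

lemma sesquilinear_diff_right:
  assumes "sesquilinear sU sV sW f"
  shows "f u (v - v') = f u v - f u v'"
  using sesquilinearD(2)[OF assms, of u "v - v'" v'] by simp

text \<open>
  Consider \<open>f (x + t y, x + t y) \<ge> 0\<close> for complex \<open>t\<close>. The values at \<open>t = 1\<close> and \<open>t = \<i>\<close> are
  real, which already forces the form to be hermitian; along \<open>t = - r f(x, y)\<close> with \<open>r\<close> real the
  expression is a real quadratic in \<open>r\<close>, and its nonnegativity bounds \<open>\<bar>f(x, y)\<bar>\<close>.
\<close>

lemma Cauchy_Schwarz_positive_sesquilinear: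
  fixes f :: "'u::ab_group_add \<Rightarrow> 'u \<Rightarrow> complex"
  assumes f: "sesquilinear sU sU (*) f"
    and pos: "\<And>x. f x x \<in> \<real>\<^sub>\<ge>\<^sub>0"
  shows "cmod (f x y) \<le> sqrt (Re (f x x)) * sqrt (Re (f y y))"
proof -
  note D = sesquilinearD[OF f]
  define a b c d where "a = Re (f x x)" "b = Re (f y y)" "c = f x y" "d = f y x"
  note defs = this
  have ab: "f x x = of_real a" "f y y = of_real b" "a \<ge> 0" "b \<ge> 0"
    using pos[of x] pos[of y] unfolding defs
    by (auto simp: complex_nonneg_Reals_iff complex_eq_iff)
  have poly: "of_real a + cnj t * c + t * d + t * cnj t * of_real b \<in> \<real>\<^sub>\<ge>\<^sub>0" for t
    using pos[of "x + sU t y"] ab(1,2) by (simp add: D defs(3,4) algebra_simps)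
  have herm: "d = cnj c"
    using poly[of 1] poly[of \<i>] by (auto simp: complex_nonneg_Reals_iff complex_eq_iff)
  have quad: "a - 2 * r * (cmod c)\<^sup>2 + r\<^sup>2 * (cmod c)\<^sup>2 * b \<ge> 0" for r
    using poly[of "- (of_real r * c)"] unfolding cmod_power2
    by (auto simp: complex_nonneg_Reals_iff herm power2_eq_square algebra_simps)
  have "(cmod c)\<^sup>2 \<le> a * b"
  proof (cases "b = 0")
    case True
    have "(cmod c)\<^sup>2 = 0"
    proof (rule ccontr)
      assume "(cmod c)\<^sup>2 \<noteq> 0"
      then show False
        using quad[of "(a + 1) / (cmod c)\<^sup>2"] True ab(3) by simp
    qed
    then show ?thesis using True by simp
  next
    case False
    then have "0 \<le> a - (cmod c)\<^sup>2 / b"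
      using quad[of "1 / b"] by (simp add: power2_eq_square field_simps)
    then show ?thesis using False ab(4) by (simp add: field_simps)
  qed
  then have "cmod c \<le> sqrt (a * b)"
    by (rule real_le_rsqrt)
  then show ?thesis
    by (simp add: defs real_sqrt_mult)
qed

lemma sesquilinear_compose_form:
  assumes \<Phi>: "sesquilinear scaleX scaleX scaleY \<Phi>"
    and \<phi>: "sesquilinear scaleY scale0 (*) \<phi>"
  shows "sesquilinear scaleX scaleX (*) (\<lambda>x1 x2. \<phi> (\<Phi> x1 x2) z)"
proof -
  have "vector_space scaleX"
    using \<Phi> by (simp add: sesquilinear_def Vector_Spaces.linear_iff)
  moreover have "vector_space ((*) :: complex \<Rightarrow> complex \<Rightarrow> complex)"
    and "vector_space (\<lambda>c w. cnj c * w)"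
    by (unfold_locales; simp add: algebra_simps)+
  ultimately show ?thesis
    unfolding sesquilinear_def Vector_Spaces.linear_iff
    by (simp add: sesquilinearD[OF \<Phi>] sesquilinearD[OF \<phi>])
qed

lemma Cauchy_Schwarz_plane_sqrt:
  fixes a1 a2 b1 b2 :: real
  assumes "0 \<le> a1" "0 \<le> a2" "0 \<le> b1" "0 \<le> b2"
  shows "sqrt a1 * sqrt b1 + sqrt a2 * sqrt b2 \<le> sqrt (a1 + a2) * sqrt (b1 + b2)"
  using L2_set_mult_ineq[of "\<lambda>i. sqrt (if i then a1 else a2)"
      "\<lambda>i. sqrt (if i then b1 else b2)" "UNIV :: bool set"] assms
  by (simp add: L2_set_def UNIV_bool add.commute)

text \<open>
  The form \<open>\<phi>\<close> is positive for second arguments in \<open>C\<close>, to which \<open>z1 - z2\<close> need not belong. So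
  Cauchy-Schwarz is applied for \<open>z1\<close> and \<open>z2\<close> separately, and adding up the two estimates
  brings in \<open>z1 + z2\<close>; this is why the decomposition of \<open>z\<close> has to control the norms of sums.
\<close>

lemma positive_form_difference_bound:
  fixes \<phi> :: "'y::real_normed_vector \<Rightarrow> 'a::real_normed_vector \<Rightarrow> complex"
  assumes \<Phi>: "sesquilinear scaleX scaleX scaleY \<Phi>" and "positive_map K \<Phi>"
    and \<phi>: "sesquilinear scaleY scale0 (*) \<phi>"
    and pos: "\<And>y z. y \<in> K \<Longrightarrow> z \<in> C \<Longrightarrow> \<phi> y z \<in> \<real>\<^sub>\<ge>\<^sub>0"
    and contr: "\<And>y z. cmod (\<phi> y z) \<le> norm y * norm z"
    and z: "z1 \<in> C" "z2 \<in> C"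
  shows "cmod (\<phi> (\<Phi> x1 x2) (z1 - z2))
    \<le> sqrt (norm (\<Phi> x1 x1)) * sqrt (norm (\<Phi> x2 x2)) * norm (z1 + z2)"
proof -
  have \<Phi>pos: "\<phi> (\<Phi> x x) z \<in> \<real>\<^sub>\<ge>\<^sub>0" if "z \<in> C" for x z
    using assms(2) that by (simp add: positive_map_def pos)
  define q where "q x z = Re (\<phi> (\<Phi> x x) z)" for x z
  have q_nonneg: "0 \<le> q x z1" "0 \<le> q x z2" for x
    using \<Phi>pos z by (auto simp: q_def complex_nonneg_Reals_iff)
  have q_add: "q x z1 + q x z2 = q x (z1 + z2)" for x
    by (simp add: q_def sesquilinearD[OF \<phi>])
  have q_le: "q x (z1 + z2) \<le> norm (\<Phi> x x) * norm (z1 + z2)" for x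
    unfolding q_def using complex_Re_le_cmod contr by (rule order_trans)
  have CS: "cmod (\<phi> (\<Phi> x1 x2) z) \<le> sqrt (q x1 z) * sqrt (q x2 z)" if "z \<in> C" for z
    unfolding q_def
    by (rule Cauchy_Schwarz_positive_sesquilinear[OF sesquilinear_compose_form[OF \<Phi> \<phi>]])
      (rule \<Phi>pos[OF that])
  have "cmod (\<phi> (\<Phi> x1 x2) (z1 - z2)) \<le> cmod (\<phi> (\<Phi> x1 x2) z1) + cmod (\<phi> (\<Phi> x1 x2) z2)"
    by (simp add: sesquilinear_diff_right[OF \<phi>] norm_triangle_ineq4)
  also have "\<dots> \<le> sqrt (q x1 z1) * sqrt (q x2 z1) + sqrt (q x1 z2) * sqrt (q x2 z2)"
    using CS z by (intro add_mono)
  also have "\<dots> \<le> sqrt (q x1 (z1 + z2)) * sqrt (q x2 (z1 + z2))"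
    using Cauchy_Schwarz_plane_sqrt q_nonneg by (simp flip: q_add)
  also have "\<dots> \<le> sqrt (norm (\<Phi> x1 x1) * norm (z1 + z2)) * sqrt (norm (\<Phi> x2 x2) * norm (z1 + z2))"
    using q_nonneg q_le by (intro mult_mono real_sqrt_le_mono) (auto simp flip: q_add)
  also have "\<dots> = sqrt (norm (\<Phi> x1 x1)) * sqrt (norm (\<Phi> x2 x2)) * norm (z1 + z2)"
    by (simp add: real_sqrt_mult)
  finally show ?thesis .
qed

theorem proposition3p10:
  fixes scaleX :: "complex \<Rightarrow> 'x::ab_group_add \<Rightarrow> 'x"
    and scale0 :: "complex \<Rightarrow> 'a::{ring, real_normed_vector} \<Rightarrow> 'a"
    and star :: "'a \<Rightarrow> 'a"
    and scaleY :: "complex \<Rightarrow> 'y::banach \<Rightarrow> 'y"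
    and lmul :: "'a \<Rightarrow> 'y \<Rightarrow> 'y"
    and rmul :: "'y \<Rightarrow> 'a \<Rightarrow> 'y"
    and K :: "'y set"
    and \<Phi> :: "'x \<Rightarrow> 'x \<Rightarrow> 'y"
  assumes X: "vector_space scaleX"
    and Y0: "complex_normed_space scale0"
    and Y: "ordered_banach_bimodule scale0 star scaleY lmul rmul K"
    and closed_K: "closed K"
    and C1: "\<And>z. \<exists>z1 \<in> star_cone star. \<exists>z2 \<in> star_cone star.
                  \<exists>z3 \<in> star_cone star. \<exists>z4 \<in> star_cone star.
               z = z1 - z2 + scale0 \<i> (z3 - z4) \<and>
               norm (z1 - z2) = norm (z1 + z2) \<and> norm (z1 + z2) \<le> norm z \<and>
               norm (z3 - z4) = norm (z3 + z4) \<and> norm (z3 + z4) \<le> norm z"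
    and C2: "\<exists>F :: ('y \<Rightarrow> 'a \<Rightarrow> complex) set.
               (\<forall>\<phi>\<in>F. sesquilinear scaleY scale0 (*) \<phi>) \<and>
               (\<forall>\<phi>\<in>F. \<forall>y\<in>K. \<forall>z\<in>star_cone star. \<phi> y z \<in> \<real>\<^sub>\<ge>\<^sub>0) \<and>
               (\<forall>\<phi>\<in>F. \<forall>y z. cmod (\<phi> y z) \<le> norm y * norm z) \<and>
               (\<forall>y. norm y = (SUP z\<in>{z. norm z \<le> 1}. SUP \<phi>\<in>F. cmod (\<phi> y z)))"
    and sesq: "sesquilinear scaleX scaleX scaleY \<Phi>"
    and pos: "positive_map K \<Phi>"
  shows "\<forall>x1 x2. norm (\<Phi> x1 x2) \<le> 2 * sqrt (norm (\<Phi> x1 x1)) * sqrt (norm (\<Phi> x2 x2))"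
proof (intro allI)
  fix x1 x2
  let ?M = "sqrt (norm (\<Phi> x1 x1)) * sqrt (norm (\<Phi> x2 x2))"
  obtain F :: "('y \<Rightarrow> 'a \<Rightarrow> complex) set" where
    F_sesq: "\<And>\<phi>. \<phi> \<in> F \<Longrightarrow> sesquilinear scaleY scale0 (*) \<phi>" and
    F_pos: "\<And>\<phi> y z. \<phi> \<in> F \<Longrightarrow> y \<in> K \<Longrightarrow> z \<in> star_cone star \<Longrightarrow> \<phi> y z \<in> \<real>\<^sub>\<ge>\<^sub>0" and
    F_contr: "\<And>\<phi> y z. \<phi> \<in> F \<Longrightarrow> cmod (\<phi> y z) \<le> norm y * norm z" and
    F_norming: "\<And>y. norm y = (SUP z\<in>{z. norm z \<le> 1}. SUP \<phi>\<in>F. cmod (\<phi> y z))"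
    using C2 by metis
  have bound: "cmod (\<phi> (\<Phi> x1 x2) z) \<le> 2 * ?M" if \<phi>: "\<phi> \<in> F" and z: "norm z \<le> 1" for \<phi> z
  proof -
    obtain z1 z2 z3 z4 where
      mem: "z1 \<in> star_cone star" "z2 \<in> star_cone star" "z3 \<in> star_cone star" "z4 \<in> star_cone star"
      and z_eq: "z = z1 - z2 + scale0 \<i> (z3 - z4)"
      and le: "norm (z1 + z2) \<le> norm z" "norm (z3 + z4) \<le> norm z"
      using C1[of z] by metis
    have part: "cmod (\<phi> (\<Phi> x1 x2) (u - v)) \<le> ?M"
      if "u \<in> star_cone star" "v \<in> star_cone star" "norm (u + v) \<le> norm z" for u v
    proof -
      have "cmod (\<phi> (\<Phi> x1 x2) (u - v)) \<le> ?M * norm (u + v)"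
        by (rule positive_form_difference_bound[OF sesq pos F_sesq[OF \<phi>], where C = "star_cone star"])
          (use that F_pos[OF \<phi>] F_contr[OF \<phi>] in auto)
      also have "\<dots> \<le> ?M"
        using that(3) z by (intro mult_left_le) auto
      finally show ?thesis .
    qed
    have "\<phi> (\<Phi> x1 x2) z = \<phi> (\<Phi> x1 x2) (z1 - z2) + cnj \<i> * \<phi> (\<Phi> x1 x2) (z3 - z4)"
      unfolding z_eq by (simp only: sesquilinearD[OF F_sesq[OF \<phi>]])
    then have "cmod (\<phi> (\<Phi> x1 x2) z)
        \<le> cmod (\<phi> (\<Phi> x1 x2) (z1 - z2)) + cmod (\<phi> (\<Phi> x1 x2) (z3 - z4))"
      by (metis complex_mod_cnj mult_1 norm_ii norm_mult norm_triangle_ineq)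
    also have "\<dots> \<le> ?M + ?M"
      using mem le by (intro add_mono part)
    finally show ?thesis by simp
  qed
  have "norm (\<Phi> x1 x2) \<le> 2 * ?M"
  proof (cases "F = {}")
    \<comment> \<open>For an empty family the norming formula does not depend on \<open>y\<close>, so every norm equals
      that of \<open>0\<close>.\<close>
    case True
    then have "norm (\<Phi> x1 x2) = norm (0 :: 'y)"
      by (simp only: F_norming image_empty)
    then show ?thesis by simp
  next
    case False
    have "(SUP z\<in>{z. norm z \<le> 1}. SUP \<phi>\<in>F. cmod (\<phi> (\<Phi> x1 x2) z)) \<le> 2 * ?M"
    proof (rule cSUP_least)
      show "{z :: 'a. norm z \<le> 1} \<noteq> {}"
        by (auto intro: exI[of _ 0])
    next
      fix z :: 'a
      assume "z \<in> {z. norm z \<le> 1}"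
      with False show "(SUP \<phi>\<in>F. cmod (\<phi> (\<Phi> x1 x2) z)) \<le> 2 * ?M"
        by (intro cSUP_least) (auto intro: bound)
    qed
    then show ?thesis by (simp only: F_norming[of "\<Phi> x1 x2"])
  qed
  then show "norm (\<Phi> x1 x2) \<le> 2 * sqrt (norm (\<Phi> x1 x1)) * sqrt (norm (\<Phi> x2 x2))"
    by (simp only: mult.assoc)
qed

end
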